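(* Let $h\ge 1$ and $m_1,\dots,m_h,n_1,\dots,n_h$ be positive integers, and let $G=\mathrm{NSG}(m_1,\ldots,m_h;n_1,\ldots,n_h)$. Let $\lambda\neq 0,-1$ be an eigenvalue of $G$ other than the largest eigenvalue $\lambda_1(G)$. Then every vertex in $U_1\cup V_1$ is a downer vertex for $\lambda$, and every vertex in $U_h$ is a downer vertex for $\lambda$. Moreover, every vertex in $V_h$ is a downer vertex for $\lambda$, unless $\lambda=-m_h$ and $m_h\ge 2$.
   Context: All graphs are simple; eigenvalues of a graph are those of its adjacency matrix, listed as $\lambda_1\ge\lambda_2\ge\cdots\ge\lambda_n$. The nested split (threshold) graph $\mathrm{NSG}(m_1,\ldots,m_h;n_1,\ldots,n_h)$ has vertex set the disjoint union of sets $U_1,\dots,U_h,V_1,\dots,V_h$ with $|U_i|=m_i$, $|V_i|=n_i$; the set $V=\bigcup_i V_i$ induces a clique, the set $U=\bigcup_i U_i$ induces a co-clique (independent set), and a vertex $u\in U_i$ is adjacent to a vertex $v\in V_j$ if and only if $j\le i$. For an eigenvalue $\lambda$ of a graph $G$ of multiplicity $k\ge1$ and a vertex $v$, $v$ is a downer, neutral, or Parter vertex for $\lambda$ according as the multiplicity of $\lambda$ as an eigenvalue of $G-v$ is $k-1$, $k$, or $k+1$. *)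

theory Defs
  imports
    "Graph_Theory.Graph_Theory"
    "Jordan_Normal_Form.Char_Poly"
    "HOL-Computational_Algebra.Polynomial"
begin

(* The vertices are arranged along an arbitrary enumeration; a different one conjugates the
   matrix by a permutation matrix, which affects neither the eigenvalues nor the
   characteristic polynomial. *)
definition vertex_enum :: "('a, 'b) pre_digraph \<Rightarrow> 'a list" where
  "vertex_enum G = (SOME vs. distinct vs \<and> set vs = verts G)"

definition adjacency_matrix :: "('a, 'b) pre_digraph \<Rightarrow> real mat" where
  "adjacency_matrix G =
     (let vs = vertex_enum G; n = length vs
      in mat n n (\<lambda>(i, j). if vs ! i \<rightarrow>\<^bsub>G\<^esub> vs ! j then 1 else 0))"

definition graph_eigenvalue :: "('a, 'b) pre_digraph \<Rightarrow> real \<Rightarrow> bool" where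
  "graph_eigenvalue G k \<longleftrightarrow> eigenvalue (adjacency_matrix G) k"

(* Algebraic multiplicity; it is 0 if the number is not an eigenvalue. *)
definition eigenvalue_mult :: "('a, 'b) pre_digraph \<Rightarrow> real \<Rightarrow> nat" where
  "eigenvalue_mult G k = order k (char_poly (adjacency_matrix G))"

(* For a finite nonempty graph the set is finite, and it is nonempty because the matrix is
   real symmetric. *)
definition largest_eigenvalue :: "('a, 'b) pre_digraph \<Rightarrow> real" where
  "largest_eigenvalue G = Max {k. graph_eigenvalue G k}"

definition downer_vertex :: "('a, 'b) pre_digraph \<Rightarrow> real \<Rightarrow> 'a \<Rightarrow> bool" where
  "downer_vertex G k v \<longleftrightarrow>
     v \<in> verts G \<and> eigenvalue_mult G k \<ge> 1 \<and>
     eigenvalue_mult (pre_digraph.del_vert G v) k = eigenvalue_mult G k - 1"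

(* U_vertex i k and V_vertex i k are the k-th vertices of the cells U_i and V_i,
   where i = 1..h and k is counted from 0. *)
datatype nsg_vertex = U_vertex nat nat | V_vertex nat nat

definition U_cell :: "(nat \<Rightarrow> nat) \<Rightarrow> nat \<Rightarrow> nsg_vertex set" where
  "U_cell m i = {U_vertex i k |k. k < m i}"

definition V_cell :: "(nat \<Rightarrow> nat) \<Rightarrow> nat \<Rightarrow> nsg_vertex set" where
  "V_cell n i = {V_vertex i k |k. k < n i}"

fun nsg_adj :: "nsg_vertex \<Rightarrow> nsg_vertex \<Rightarrow> bool" where
  "nsg_adj (U_vertex _ _) (U_vertex _ _) \<longleftrightarrow> False"
| "nsg_adj (V_vertex i k) (V_vertex j l) \<longleftrightarrow> (i, k) \<noteq> (j, l)"
| "nsg_adj (U_vertex i _) (V_vertex j _) \<longleftrightarrow> j \<le> i"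
| "nsg_adj (V_vertex j _) (U_vertex i _) \<longleftrightarrow> j \<le> i"

definition nsg_verts :: "nat \<Rightarrow> (nat \<Rightarrow> nat) \<Rightarrow> (nat \<Rightarrow> nat) \<Rightarrow> nsg_vertex set" where
  "nsg_verts h m n = (\<Union>i\<in>{1..h}. U_cell m i) \<union> (\<Union>i\<in>{1..h}. V_cell n i)"

(* Undirected edges are represented by pairs of opposite arcs; only the values of m and n on
   {1..h} matter. *)
definition NSG :: "nat \<Rightarrow> (nat \<Rightarrow> nat) \<Rightarrow> (nat \<Rightarrow> nat) \<Rightarrow> nsg_vertex pair_pre_digraph" where
  "NSG h m n =
     \<lparr> pverts = nsg_verts h m n,
       parcs = {(x, y). x \<in> nsg_verts h m n \<and> y \<in> nsg_verts h m n \<and> nsg_adj x y} \<rparr>"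

lemma finite_nsg_verts: "finite (nsg_verts h m n)"
  by (auto simp: nsg_verts_def U_cell_def V_cell_def)

lemma nsg_adj_sym: "nsg_adj x y \<Longrightarrow> nsg_adj y x"
  by (cases x; cases y) auto

lemma nsg_adj_irrefl: "\<not> nsg_adj x x"
  by (cases x) auto

lemma pair_graph_NSG: "pair_graph (NSG h m n)"
proof
  show "finite (pverts (NSG h m n))"
    by (simp add: NSG_def finite_nsg_verts)
  have "parcs (NSG h m n) \<subseteq> nsg_verts h m n \<times> nsg_verts h m n"
    by (auto simp: NSG_def)
  then show "finite (parcs (NSG h m n))"
    by (rule finite_subset) (simp add: finite_nsg_verts)
  show "symmetric (with_proj (NSG h m n))"
    by (auto simp: symmetric_def sym_def NSG_def arcs_ends_conv image_iff intro: nsg_adj_sym)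
qed (auto simp: NSG_def nsg_adj_irrefl)

end

theory Submission
  imports Defs
begin

text \<open>
  Call a function on the vertices whose neighbour sums are \<open>\<theta>\<close> times its values an eigenfunction.
  If every eigenfunction for \<open>\<theta>\<close> that vanishes at \<open>v\<close> is zero, then \<open>\<theta>\<close> is simple. It is then
  not an eigenvalue of \<open>G - v\<close>: an eigenfunction of \<open>G - v\<close>, extended by \<open>0\<close>, satisfies the
  eigenvalue equation at \<open>v\<close> too, because the error is orthogonal to an eigenfunction of \<open>G\<close>
  with nonzero value at \<open>v\<close>. So \<open>v\<close> is a downer vertex.

  For \<open>\<theta> \<noteq> 0, -1\<close> an eigenfunction of a nested split graph is constant on cells, with values
  \<open>a\<^sub>i\<close> on \<open>U\<^sub>i\<close> and \<open>b\<^sub>i\<close> on \<open>V\<^sub>i\<close> subject to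
  \<open>\<theta> a\<^sub>i\<^sub>+\<^sub>1 = \<theta> a\<^sub>i + n\<^sub>i\<^sub>+\<^sub>1 b\<^sub>i\<^sub>+\<^sub>1\<close> and \<open>(\<theta> + 1) b\<^sub>i = (\<theta> + 1) b\<^sub>i\<^sub>+\<^sub>1 + m\<^sub>i a\<^sub>i\<close>, with boundary
  conditions \<open>\<theta> a\<^sub>1 = n\<^sub>1 b\<^sub>1\<close> and \<open>(\<theta> + 1) b\<^sub>h = (\<theta> + m\<^sub>h) a\<^sub>h\<close>. Hence a zero in the first cells
  propagates forwards to all cells, and a zero in the last cells backwards, except when only
  \<open>b\<^sub>h\<close> is known to vanish and \<open>\<theta> = - m\<^sub>h\<close>.
\<close>

section \<open>Simple eigenvalues of real symmetric matrices\<close>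

lemma det_replace_col:
  fixes A :: "'a :: comm_ring_1 mat"
  assumes A: "A \<in> carrier_mat n n" and k: "k < n"
  shows "det (replace_col A b k) = (\<Sum>i<n. b $ i * cofactor A i k)"
proof -
  have "replace_col A b k \<in> carrier_mat n n"
    using A by (auto simp: replace_col_def)
  moreover have "cofactor (replace_col A b k) i k = cofactor A i k" if "i < n" for i
  proof -
    have "mat_delete (replace_col A b k) i k = mat_delete A i k"
      using A k that by (intro eq_matI) (auto simp: mat_delete_def replace_col_def)
    then show ?thesis by (simp add: cofactor_def)
  qed
  ultimately show ?thesis
    using A k by (subst laplace_expansion_column[of _ n k]) (auto simp: replace_col_def)
qed

lemma det_replace_col_smult:
  fixes A :: "'a :: comm_ring_1 mat"
  assumes "A \<in> carrier_mat n n" "b \<in> carrier_vec n" "k < n"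
  shows "det (replace_col A (c \<cdot>\<^sub>v b) k) = c * det (replace_col A b k)"
  using assms by (simp add: det_replace_col sum_distrib_left mult.assoc)

text \<open>Symmetry moves \<open>A\<close> across the scalar product, where it acts on
  \<open>x\<close> as the scalar \<open>k\<close>. So the range of \<open>A - kI\<close> is
  orthogonal to the eigenspace.\<close>

lemma symmetric_mat_orthogonal:
  fixes A :: "'a :: comm_ring_1 mat"
  assumes A: "A \<in> carrier_mat n n" and sym: "A\<^sup>T = A"
    and x: "x \<in> carrier_vec n" and Ax: "A *\<^sub>v x = k \<cdot>\<^sub>v x" and z: "z \<in> carrier_vec n"
  shows "x \<bullet> (A *\<^sub>v z - k \<cdot>\<^sub>v z) = 0"
proof -
  have "x \<bullet> (A *\<^sub>v z) = (A *\<^sub>v x) \<bullet> z"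
    using transpose_vec_mult_scalar[OF A z x] A x z sym
    by (metis comm_scalar_prod mult_mat_vec_carrier)
  also have "\<dots> = k * (x \<bullet> z)"
    using x z by (simp add: Ax)
  finally show ?thesis
    using A x z by (simp add: scalar_prod_minus_distrib)
qed

text \<open>A kernel vector \<open>y\<close> of the replaced matrix would make \<open>y $ k\<close>
  times \<open>x\<close> lie in the range of \<open>A - \<theta>I\<close>, hence be orthogonal to
  \<open>x\<close>. Then \<open>y $ k = 0\<close>, and \<open>y\<close> is an eigenvector vanishing
  at \<open>k\<close>, contrary to \<open>nz\<close>.\<close>

lemma det_replace_col_eigenvector_nonzero:
  fixes A :: "real mat"
  assumes A: "A \<in> carrier_mat n n" and sym: "A\<^sup>T = A" and x: "eigenvector A x \<theta>"
    and k: "k < n" and nz: "\<And>y. eigenvector A y \<theta> \<Longrightarrow> y $ k \<noteq> 0"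
  shows "det (replace_col (\<theta> \<cdot>\<^sub>m 1\<^sub>m n - A) x k) \<noteq> 0"
proof
  let ?D = "replace_col (\<theta> \<cdot>\<^sub>m 1\<^sub>m n - A) x k"
  have D: "?D \<in> carrier_mat n n"
    using A by (auto simp: replace_col_def)
  have xc: "x \<in> carrier_vec n" and x0: "x \<noteq> 0\<^sub>v n" and Ax: "A *\<^sub>v x = \<theta> \<cdot>\<^sub>v x"
    using x A by (auto simp: eigenvector_def)
  assume "det ?D = 0"
  then obtain y where y: "y \<in> carrier_vec n" "y \<noteq> 0\<^sub>v n" "?D *\<^sub>v y = 0\<^sub>v n"
    using det_0_iff_vec_prod_zero[OF D] by blast
  \<comment> \<open>Column \<open>k\<close> of \<open>?D\<close> is \<open>x\<close>, so only the
    other entries of \<open>y\<close> meet columns of \<open>\<theta>I - A\<close>. Zeroing entry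
    \<open>k\<close> separates the two contributions.\<close>
  define z where "z = vec n (\<lambda>i. if i = k then 0 else y $ i)"
  have z: "z \<in> carrier_vec n" by (simp add: z_def)
  have eq: "A *\<^sub>v z - \<theta> \<cdot>\<^sub>v z = y $ k \<cdot>\<^sub>v x"
  proof (rule eq_vecI)
    fix i assume "i < dim_vec (y $ k \<cdot>\<^sub>v x)"
    then have i: "i < n" using xc by simp
    have "0 = (?D *\<^sub>v y) $ i" using y i by simp
    also have "\<dots> = (\<Sum>j<n. ?D $$ (i, j) * y $ j)"
      using D y(1) i by (auto simp: scalar_prod_def lessThan_atLeast0)
    also have "\<dots> = (\<Sum>j<n. (if j = k then x $ i * y $ k else 0)
        + ((if j = i then \<theta> * z $ i else 0) - A $$ (i, j) * z $ j))"
      using A i by (intro sum.cong) (auto simp: replace_col_def z_def algebra_simps)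
    also have "\<dots> = x $ i * y $ k + (\<theta> * z $ i - (\<Sum>j<n. A $$ (i, j) * z $ j))"
      using i k by (simp add: sum.distrib sum_subtractf)
    also have "(\<Sum>j<n. A $$ (i, j) * z $ j) = (A *\<^sub>v z) $ i"
      using A z i by (auto simp: scalar_prod_def lessThan_atLeast0)
    finally show "(A *\<^sub>v z - \<theta> \<cdot>\<^sub>v z) $ i = (y $ k \<cdot>\<^sub>v x) $ i"
      using A z xc i by (simp add: algebra_simps)
  qed (use A z xc in auto)
  have "y $ k * (x \<bullet> x) = 0"
    using symmetric_mat_orthogonal[OF A sym xc Ax z] xc by (simp add: eq)
  moreover have "x \<bullet> x \<noteq> 0"
    using conjugate_square_eq_0_vec[OF xc] x0 by (simp add: conjugate_vec_def conjugate_real_def)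
  ultimately have yk: "y $ k = 0" by simp
  then have "z = y"
    using y by (auto simp: z_def)
  with eq yk xc have *: "A *\<^sub>v y - \<theta> \<cdot>\<^sub>v y = 0\<^sub>v n"
    by auto
  have "A *\<^sub>v y = \<theta> \<cdot>\<^sub>v y"
  proof (rule eq_vecI)
    fix i assume "i < dim_vec (\<theta> \<cdot>\<^sub>v y)"
    then show "(A *\<^sub>v y) $ i = (\<theta> \<cdot>\<^sub>v y) $ i"
      using arg_cong[OF *, of "\<lambda>v. v $ i"] A y by simp
  qed (use A y in auto)
  then have "eigenvector A y \<theta>"
    using A y by (auto simp: eigenvector_def)
  then show False using nz yk by blast
qed

text \<open>
  If \<open>x\<close> is an eigenvector, Cramer's rule for \<open>(tI - A) x = (t - \<theta>) x\<close> splits off exactly one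
  factor \<open>t - \<theta>\<close> of the characteristic polynomial.
\<close>
lemma order_char_poly_eq_1:
  fixes A :: "real mat"
  assumes A: "A \<in> carrier_mat n n" and sym: "A\<^sup>T = A" and ev: "eigenvalue A \<theta>"
    and k: "k < n" and nz: "\<And>y. eigenvector A y \<theta> \<Longrightarrow> y $ k \<noteq> 0"
  shows "order \<theta> (char_poly A) = 1"
proof -
  obtain x where x: "eigenvector A x \<theta>"
    using ev by (auto simp: eigenvalue_def)
  then have xc: "x \<in> carrier_vec n" and Ax: "A *\<^sub>v x = \<theta> \<cdot>\<^sub>v x"
    using A by (auto simp: eigenvector_def)
  define B where "B = char_poly_matrix A"
  define X where "X = map_vec (\<lambda>c. [:c:]) x"
  have B: "B \<in> carrier_mat n n" using A by (simp add: B_def)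
  have X: "X \<in> carrier_vec n" using xc by (simp add: X_def)
  have BX: "B *\<^sub>v X = [:-\<theta>, 1:] \<cdot>\<^sub>v X"
  proof (rule eq_vecI)
    fix i assume "i < dim_vec ([:-\<theta>, 1:] \<cdot>\<^sub>v X)"
    then have i: "i < n" using X by simp
    have "(B *\<^sub>v X) $ i = (\<Sum>j<n. B $$ (i, j) * X $ j)"
      using B X i by (auto simp: scalar_prod_def lessThan_atLeast0)
    also have "\<dots> = (\<Sum>j<n. (if j = i then [:0, x $ i:] else 0) - [:A $$ (i, j) * x $ j:])"
      using A i xc by (intro sum.cong) (auto simp: B_def char_poly_matrix_def X_def)
    also have "\<dots> = [:0, x $ i:] - (\<Sum>j<n. [:A $$ (i, j) * x $ j:])"
      using i by (simp add: sum_subtractf)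
    also have "(\<Sum>j<n. [:A $$ (i, j) * x $ j:]) = [:\<Sum>j<n. A $$ (i, j) * x $ j:]"
      by (induction n) auto
    also have "(\<Sum>j<n. A $$ (i, j) * x $ j) = (A *\<^sub>v x) $ i"
      using A xc i by (auto simp: scalar_prod_def lessThan_atLeast0)
    finally show "(B *\<^sub>v X) $ i = ([:-\<theta>, 1:] \<cdot>\<^sub>v X) $ i"
      using i xc by (simp add: X_def Ax)
  qed (use B X in auto)
  define q where "q = det (replace_col B X k)"
  have "Polynomial.smult (x $ k) (char_poly A) = X $ k * det B"
    using xc k by (simp add: X_def B_def char_poly_def)
  \<comment> \<open>Cramer's rule turns \<open>X $ k * det B\<close> into the determinant of
    \<open>B\<close> with column \<open>k\<close> replaced by \<open>BX\<close>, and the scalar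
    \<open>t - \<theta>\<close> comes out of that column.\<close>
  also have "\<dots> = [:-\<theta>, 1:] * q"
    unfolding q_def cramer_lemma_mat[OF B X k, symmetric] BX
    by (rule det_replace_col_smult[OF B X k])
  finally have factor: "Polynomial.smult (x $ k) (char_poly A) = [:-\<theta>, 1:] * q" .
  \<comment> \<open>Evaluation at \<open>\<theta>\<close> commutes with the determinant and turns
    \<open>B\<close> into \<open>\<theta>I - A\<close> and the constant polynomials \<open>X\<close>
    back into \<open>x\<close>. As \<open>q\<close> has no root at \<open>\<theta>\<close>, the
    explicit factor is the only one.\<close>
  have "poly q \<theta> = det (replace_col (\<theta> \<cdot>\<^sub>m 1\<^sub>m n - A) x k)"
    unfolding q_def
    by (rule poly_det_cong[of _ n])
      (use A xc B in \<open>auto simp: replace_col_def B_def char_poly_matrix_def X_def\<close>)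
  then have q: "poly q \<theta> \<noteq> 0"
    using det_replace_col_eigenvector_nonzero[OF A sym x k nz] by simp
  have xk: "x $ k \<noteq> 0" using nz x by blast
  have "order \<theta> ([:-\<theta>, 1:] * q) = order \<theta> [:-\<theta>, 1:] + order \<theta> q"
    using q by (intro order_mult) (force simp del: mult_pCons_left)
  also have "order \<theta> [:-\<theta>, 1:] = 1"
    using order_power_n_n[of \<theta> 1] by simp
  also have "order \<theta> q = 0"
    using q by (simp add: order_root)
  finally have "order \<theta> (Polynomial.smult (x $ k) (char_poly A)) = 1"
    by (simp only: factor)
  then show ?thesis
    using xk by (simp add: order_smult)
qed

section \<open>Eigenfunctions of a graph\<close>

definition eigenfunction :: "('a, 'b) pre_digraph \<Rightarrow> real \<Rightarrow> ('a \<Rightarrow> real) \<Rightarrow> bool" where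
  "eigenfunction G k x \<longleftrightarrow>
     (\<forall>u\<in>verts G. (\<Sum>w\<in>verts G. if u \<rightarrow>\<^bsub>G\<^esub> w then x w else 0) = k * x u)"

lemma vertex_enum:
  assumes "finite (verts G)"
  shows "distinct (vertex_enum G)" "set (vertex_enum G) = verts G"
proof -
  have "\<exists>vs. distinct vs \<and> set vs = verts G"
    using finite_distinct_list[OF assms] by blast
  from someI_ex[OF this] show "distinct (vertex_enum G)" "set (vertex_enum G) = verts G"
    by (auto simp: vertex_enum_def)
qed

lemma bij_betw_vertex_enum:
  assumes "finite (verts G)"
  shows "bij_betw ((!) (vertex_enum G)) {..<length (vertex_enum G)} (verts G)"
  using vertex_enum[OF assms] by (intro bij_betw_nth) auto

lemma adjacency_matrix_carrier:
  "adjacency_matrix G \<in> carrier_mat (length (vertex_enum G)) (length (vertex_enum G))"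
  by (simp add: adjacency_matrix_def Let_def)

lemma adjacency_matrix_mult_vec:
  assumes fin: "finite (verts G)" and i: "i < length (vertex_enum G)"
  shows "(adjacency_matrix G *\<^sub>v vec (length (vertex_enum G)) (\<lambda>j. x (vertex_enum G ! j))) $ i
    = (\<Sum>w\<in>verts G. if vertex_enum G ! i \<rightarrow>\<^bsub>G\<^esub> w then x w else 0)"
proof -
  let ?vs = "vertex_enum G"
  have "(adjacency_matrix G *\<^sub>v vec (length ?vs) (\<lambda>j. x (?vs ! j))) $ i
    = (\<Sum>j\<in>{..<length ?vs}. if ?vs ! i \<rightarrow>\<^bsub>G\<^esub> ?vs ! j then x (?vs ! j) else 0)"
    using i by (auto simp: adjacency_matrix_def Let_def scalar_prod_def lessThan_atLeast0
        intro!: sum.cong)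
  also have "\<dots> = (\<Sum>w\<in>verts G. if ?vs ! i \<rightarrow>\<^bsub>G\<^esub> w then x w else 0)"
    by (rule sum.reindex_bij_betw[OF bij_betw_vertex_enum[OF fin]])
  finally show ?thesis .
qed

lemma eigenvector_adjacency_matrix_iff:
  assumes fin: "finite (verts G)"
  shows "eigenvector (adjacency_matrix G)
      (vec (length (vertex_enum G)) (\<lambda>j. x (vertex_enum G ! j))) k
    \<longleftrightarrow> eigenfunction G k x \<and> (\<exists>u\<in>verts G. x u \<noteq> 0)"
proof -
  let ?vs = "vertex_enum G"
  let ?n = "length ?vs"
  let ?X = "vec ?n (\<lambda>j. x (?vs ! j))"
  have all: "(\<forall>u\<in>verts G. P u) \<longleftrightarrow> (\<forall>i<?n. P (?vs ! i))" for P
    using vertex_enum(2)[OF fin] by (metis in_set_conv_nth nth_mem)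
  have "?X = 0\<^sub>v ?n \<longleftrightarrow> (\<forall>u\<in>verts G. x u = 0)"
    unfolding all by (auto simp: vec_eq_iff)
  moreover have "adjacency_matrix G *\<^sub>v ?X = k \<cdot>\<^sub>v ?X \<longleftrightarrow> eigenfunction G k x"
    using adjacency_matrix_carrier[of G] adjacency_matrix_mult_vec[OF fin]
    unfolding eigenfunction_def all by (auto simp: vec_eq_iff)
  ultimately show ?thesis
    using adjacency_matrix_carrier[of G] by (auto simp: eigenvector_def)
qed

lemma vec_eq_function_on_verts:
  assumes fin: "finite (verts G)" and w: "w \<in> carrier_vec (length (vertex_enum G))"
  obtains x where "w = vec (length (vertex_enum G)) (\<lambda>j. x (vertex_enum G ! j))"
proof
  let ?vs = "vertex_enum G"
  \<comment> \<open>The enumeration is injective on indices, so inverting it reads off the entry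
    belonging to each vertex.\<close>
  let ?x = "\<lambda>u. w $ inv_into {..<length ?vs} ((!) ?vs) u"
  show "w = vec (length ?vs) (\<lambda>j. ?x (?vs ! j))"
    using w inv_into_f_f[OF bij_betw_imp_inj_on[OF bij_betw_vertex_enum[OF fin]]]
    by (intro eq_vecI) auto
qed

lemma graph_eigenvalue_iff_eigenfunction:
  assumes fin: "finite (verts G)"
  shows "graph_eigenvalue G k \<longleftrightarrow> (\<exists>x. eigenfunction G k x \<and> (\<exists>u\<in>verts G. x u \<noteq> 0))"
proof
  assume "graph_eigenvalue G k"
  then obtain w where w: "eigenvector (adjacency_matrix G) w k"
    by (auto simp: graph_eigenvalue_def eigenvalue_def)
  then have "w \<in> carrier_vec (length (vertex_enum G))"
    using adjacency_matrix_carrier[of G] by (auto simp: eigenvector_def)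
  with vec_eq_function_on_verts[OF fin]
  obtain x where "w = vec (length (vertex_enum G)) (\<lambda>j. x (vertex_enum G ! j))" by metis
  with w show "\<exists>x. eigenfunction G k x \<and> (\<exists>u\<in>verts G. x u \<noteq> 0)"
    using eigenvector_adjacency_matrix_iff[OF fin] by blast
next
  assume "\<exists>x. eigenfunction G k x \<and> (\<exists>u\<in>verts G. x u \<noteq> 0)"
  then show "graph_eigenvalue G k"
    using eigenvector_adjacency_matrix_iff[OF fin]
    by (auto simp: graph_eigenvalue_def eigenvalue_def)
qed

text \<open>The characteristic polynomial is monic, hence nonzero, so its order at \<open>k\<close>
  is positive exactly at a root.\<close>

lemma eigenvalue_mult_eq_0_iff:
  "eigenvalue_mult G k = 0 \<longleftrightarrow> \<not> graph_eigenvalue G k"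
proof -
  note A = adjacency_matrix_carrier[of G]
  have "char_poly (adjacency_matrix G) \<noteq> 0"
    using degree_monic_char_poly[OF A] by auto
  then show ?thesis
    by (auto simp: eigenvalue_mult_def graph_eigenvalue_def order_root
        eigenvalue_root_char_poly[OF A])
qed

lemma eigenvalue_mult_eq_1:
  assumes fin: "finite (verts G)" and sym: "\<And>u w. u \<rightarrow>\<^bsub>G\<^esub> w \<Longrightarrow> w \<rightarrow>\<^bsub>G\<^esub> u"
    and v: "v \<in> verts G" and ev: "graph_eigenvalue G k"
    and nz: "\<And>y u. eigenfunction G k y \<Longrightarrow> y v = 0 \<Longrightarrow> u \<in> verts G \<Longrightarrow> y u = 0"
  shows "eigenvalue_mult G k = 1"
proof -
  let ?A = "adjacency_matrix G"
  obtain i where i: "i < length (vertex_enum G)" "vertex_enum G ! i = v"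
    using vertex_enum(2)[OF fin] v by (metis in_set_conv_nth)
  have comm: "u \<rightarrow>\<^bsub>G\<^esub> w \<longleftrightarrow> w \<rightarrow>\<^bsub>G\<^esub> u" for u w
    using sym by blast
  have "?A\<^sup>T = ?A"
    by (rule eq_matI) (simp_all add: adjacency_matrix_def Let_def comm)
  moreover have "y $ i \<noteq> 0" if y: "eigenvector ?A y k" for y
  proof
    assume "y $ i = 0"
    have "y \<in> carrier_vec (length (vertex_enum G))"
      using y adjacency_matrix_carrier[of G] by (auto simp: eigenvector_def)
    with vec_eq_function_on_verts[OF fin]
    obtain x where x: "y = vec (length (vertex_enum G)) (\<lambda>j. x (vertex_enum G ! j))" by metis
    then have "eigenfunction G k x" "\<exists>u\<in>verts G. x u \<noteq> 0"
      using y eigenvector_adjacency_matrix_iff[OF fin] by blast+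
    moreover have "x v = 0" using x i \<open>y $ i = 0\<close> by simp
    ultimately show False using nz by blast
  qed
  ultimately show ?thesis
    unfolding eigenvalue_mult_def
    using ev[unfolded graph_eigenvalue_def]
    by (intro order_char_poly_eq_1[OF adjacency_matrix_carrier _ _ i(1)])
qed

text \<open>The graph form of the orthogonality for symmetric matrices: swapping the double sum lets
  the adjacency act on \<open>x\<close> instead of \<open>z\<close>.\<close>

lemma eigenfunction_orthogonal:
  assumes sym: "\<And>u w. u \<rightarrow>\<^bsub>G\<^esub> w \<Longrightarrow> w \<rightarrow>\<^bsub>G\<^esub> u" and x: "eigenfunction G k x"
  shows "(\<Sum>u\<in>verts G. x u * ((\<Sum>w\<in>verts G. if u \<rightarrow>\<^bsub>G\<^esub> w then z w else 0) - k * z u)) = 0"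
proof -
  have comm: "u \<rightarrow>\<^bsub>G\<^esub> w \<longleftrightarrow> w \<rightarrow>\<^bsub>G\<^esub> u" for u w
    using sym by blast
  have "(\<Sum>u\<in>verts G. x u * (\<Sum>w\<in>verts G. if u \<rightarrow>\<^bsub>G\<^esub> w then z w else 0))
      = (\<Sum>u\<in>verts G. \<Sum>w\<in>verts G. z w * (if w \<rightarrow>\<^bsub>G\<^esub> u then x u else 0))"
    unfolding sum_distrib_left by (intro sum.cong) (simp_all add: comm)
  also have "\<dots> = (\<Sum>w\<in>verts G. z w * (\<Sum>u\<in>verts G. if w \<rightarrow>\<^bsub>G\<^esub> u then x u else 0))"
    by (subst sum.swap) (simp add: sum_distrib_left)
  also have "\<dots> = (\<Sum>w\<in>verts G. z w * (k * x w))"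
    using x by (intro sum.cong) (auto simp: eigenfunction_def)
  finally show ?thesis
    by (simp add: algebra_simps sum_subtractf)
qed

section \<open>Deleting a vertex\<close>

lemma arcs_ends_del_vert:
  "u \<rightarrow>\<^bsub>pre_digraph.del_vert G v\<^esub> w \<longleftrightarrow> u \<rightarrow>\<^bsub>G\<^esub> w \<and> u \<noteq> v \<and> w \<noteq> v"
  by (auto simp: arcs_ends_conv pre_digraph.del_vert_def)

lemma eigenfunction_extend_by_0:
  assumes fin: "finite (verts G)" and sym: "\<And>u w. u \<rightarrow>\<^bsub>G\<^esub> w \<Longrightarrow> w \<rightarrow>\<^bsub>G\<^esub> u"
    and v: "v \<in> verts G" and x: "eigenfunction G k x" "x v \<noteq> 0"
    and y: "eigenfunction (pre_digraph.del_vert G v) k y"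
  shows "eigenfunction G k (y(v := 0))"
proof -
  let ?z = "y(v := 0)"
  let ?d = "\<lambda>u. (\<Sum>w\<in>verts G. if u \<rightarrow>\<^bsub>G\<^esub> w then ?z w else 0) - k * ?z u"
  have d: "?d u = 0" if u: "u \<in> verts G - {v}" for u
  proof -
    have "(\<Sum>w\<in>verts G. if u \<rightarrow>\<^bsub>G\<^esub> w then ?z w else 0)
        = (\<Sum>w\<in>verts G - {v}. if u \<rightarrow>\<^bsub>pre_digraph.del_vert G v\<^esub> w then y w else 0)"
      using fin u by (intro sum.mono_neutral_cong_right) (auto simp: arcs_ends_del_vert)
    then show ?thesis
      using y u by (simp add: eigenfunction_def pre_digraph.verts_del_vert)
  qed
  \<comment> \<open>The defect \<open>?d\<close> lives only at \<open>v\<close>, so orthogonality to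
    \<open>x\<close> reduces to a single term, and \<open>x v\<close> is nonzero.\<close>
  have "(\<Sum>u\<in>verts G. x u * ?d u) = x v * ?d v"
    using d by (subst sum.remove[OF fin v]) simp
  then have "?d v = 0"
    using eigenfunction_orthogonal[OF sym x(1), of ?z] x(2) by simp
  with d have "?d u = 0" if "u \<in> verts G" for u
    using that by blast
  then show ?thesis
    by (auto simp: eigenfunction_def)
qed

text \<open>The multiplicity is 1 in \<open>G\<close> and 0 after the deletion, since
  \<open>nz\<close> rules out a nonzero eigenfunction extended by 0.\<close>

lemma downer_vertexI:
  assumes fin: "finite (verts G)" and sym: "\<And>u w. u \<rightarrow>\<^bsub>G\<^esub> w \<Longrightarrow> w \<rightarrow>\<^bsub>G\<^esub> u"
    and v: "v \<in> verts G" and ev: "graph_eigenvalue G k"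
    and nz: "\<And>y u. eigenfunction G k y \<Longrightarrow> y v = 0 \<Longrightarrow> u \<in> verts G \<Longrightarrow> y u = 0"
  shows "downer_vertex G k v"
proof -
  let ?H = "pre_digraph.del_vert G v"
  obtain x where x: "eigenfunction G k x" "x v \<noteq> 0"
    using ev nz graph_eigenvalue_iff_eigenfunction[OF fin] by blast
  have "\<not> graph_eigenvalue ?H k"
  proof
    assume "graph_eigenvalue ?H k"
    moreover have "finite (verts ?H)"
      using fin by (simp add: pre_digraph.verts_del_vert)
    ultimately obtain y u
      where y: "eigenfunction ?H k y" and u: "u \<in> verts ?H" "y u \<noteq> 0"
      using graph_eigenvalue_iff_eigenfunction by blast
    have "eigenfunction G k (y(v := 0))"
      by (rule eigenfunction_extend_by_0[OF fin sym v x y])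
    then have "(y(v := 0)) u = 0"
      by (rule nz) (use u in \<open>simp_all add: pre_digraph.verts_del_vert\<close>)
    moreover have "u \<noteq> v" using u by (auto simp: pre_digraph.verts_del_vert)
    ultimately show False
      using u by simp
  qed
  moreover have "eigenvalue_mult G k = 1"
    using fin sym v ev nz by (rule eigenvalue_mult_eq_1)
  ultimately show ?thesis
    using v by (simp add: downer_vertex_def eigenvalue_mult_eq_0_iff)
qed

section \<open>Eigenfunctions of nested split graphs\<close>

lemma pverts_NSG: "pverts (NSG h m n) = nsg_verts h m n"
  by (simp add: NSG_def)

lemma parcs_NSG:
  "(u, w) \<in> parcs (NSG h m n) \<longleftrightarrow> u \<in> nsg_verts h m n \<and> w \<in> nsg_verts h m n \<and> nsg_adj u w"
  by (simp add: NSG_def)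

lemma sum_cells:
  fixes f :: "nsg_vertex \<Rightarrow> real"
  assumes "finite I"
  shows "(\<Sum>w\<in>(\<Union>i\<in>I. U_cell m i). f w) = (\<Sum>i\<in>I. \<Sum>w\<in>U_cell m i. f w)"
    and "(\<Sum>w\<in>(\<Union>i\<in>I. V_cell n i). f w) = (\<Sum>i\<in>I. \<Sum>w\<in>V_cell n i. f w)"
  by (rule sum.UNION_disjoint; use assms in \<open>auto simp: U_cell_def V_cell_def\<close>)+

lemma card_cells: "card (U_cell m i) = m i" "card (V_cell n i) = n i"
proof -
  have "U_cell m i = U_vertex i ` {..<m i}" "V_cell n i = V_vertex i ` {..<n i}"
    by (auto simp: U_cell_def V_cell_def)
  then show "card (U_cell m i) = m i" "card (V_cell n i) = n i"
    by (auto simp: card_image inj_on_def)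
qed

lemma NSG_neighbour_sum:
  fixes x :: "nsg_vertex \<Rightarrow> real"
  assumes x: "eigenfunction (with_proj (NSG h m n)) k x" and i: "i \<in> {1..h}"
  shows "u \<in> U_cell m i \<Longrightarrow> k * x u = (\<Sum>j=1..i. \<Sum>w\<in>V_cell n j. x w)"
    and "u \<in> V_cell n i \<Longrightarrow> (k + 1) * x u
      = (\<Sum>j=1..h. \<Sum>w\<in>V_cell n j. x w) + (\<Sum>j=i..h. \<Sum>w\<in>U_cell m j. x w)"
proof -
  let ?N = "\<lambda>u. {w \<in> nsg_verts h m n. nsg_adj u w}"
  have eq: "k * x u = (\<Sum>w\<in>?N u. x w)" if "u \<in> nsg_verts h m n" for u
    using x that by (auto simp: eigenfunction_def pverts_NSG parcs_NSG sum.inter_filter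
        finite_nsg_verts)
  {
    assume u: "u \<in> U_cell m i"
    then have "?N u = (\<Union>j\<in>{1..i}. V_cell n j)"
      using i by (fastforce simp: nsg_verts_def U_cell_def V_cell_def)
    moreover have "u \<in> nsg_verts h m n" using u i by (auto simp: nsg_verts_def)
    ultimately show "k * x u = (\<Sum>j=1..i. \<Sum>w\<in>V_cell n j. x w)"
      by (simp add: eq sum_cells)
  next
    assume u: "u \<in> V_cell n i"
    let ?V = "\<Union>j\<in>{1..h}. V_cell n j" and ?U = "\<Union>j\<in>{i..h}. U_cell m j"
    \<comment> \<open>A clique vertex is not its own neighbour. Adding it completes the clique sum
      and accounts for the factor \<open>k + 1\<close>.\<close>
    have N: "insert u (?N u) = ?V \<union> ?U"
      using u i by (fastforce simp: nsg_verts_def U_cell_def V_cell_def)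
    have "u \<in> nsg_verts h m n" using u i by (auto simp: nsg_verts_def)
    then have "(k + 1) * x u = (\<Sum>w\<in>insert u (?N u). x w)"
      using eq[of u] by (simp add: finite_nsg_verts nsg_adj_irrefl algebra_simps)
    also have "\<dots> = (\<Sum>w\<in>?V. x w) + (\<Sum>w\<in>?U. x w)"
      unfolding N by (rule sum.union_disjoint) (auto simp: U_cell_def V_cell_def)
    finally show "(k + 1) * x u
      = (\<Sum>j=1..h. \<Sum>w\<in>V_cell n j. x w) + (\<Sum>j=i..h. \<Sum>w\<in>U_cell m j. x w)"
      by (simp add: sum_cells)
  }
qed

text \<open>The neighbour sums depend only on the cell, so dividing by \<open>k\<close> or
  \<open>k + 1\<close> shows that \<open>x\<close> is constant on cells. Differences of consecutive
  sums give the recurrences.\<close>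

lemma NSG_cell_equations:
  fixes x :: "nsg_vertex \<Rightarrow> real"
  assumes x: "eigenfunction (with_proj (NSG h m n)) k x" and h: "h \<ge> 1"
    and k: "k \<noteq> 0" "k \<noteq> -1"
  obtains a b :: "nat \<Rightarrow> real" where
    "\<And>i u. i \<in> {1..h} \<Longrightarrow> u \<in> U_cell m i \<Longrightarrow> x u = a i"
    "\<And>i u. i \<in> {1..h} \<Longrightarrow> u \<in> V_cell n i \<Longrightarrow> x u = b i"
    "k * a 1 = n 1 * b 1"
    "\<And>i. 1 \<le> i \<Longrightarrow> i < h \<Longrightarrow> k * a (Suc i) = k * a i + n (Suc i) * b (Suc i)"
    "\<And>i. 1 \<le> i \<Longrightarrow> i < h \<Longrightarrow> (k + 1) * b i = (k + 1) * b (Suc i) + m i * a i"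
    "(k + 1) * b h = (k + m h) * a h"
proof -
  let ?NV = "\<lambda>j. \<Sum>w\<in>V_cell n j. x w" and ?NU = "\<lambda>j. \<Sum>w\<in>U_cell m j. x w"
  define a where "a i = (\<Sum>j=1..i. ?NV j) / k" for i
  define b where "b i = ((\<Sum>j=1..h. ?NV j) + (\<Sum>j=i..h. ?NU j)) / (k + 1)" for i
  have k1: "k + 1 \<noteq> 0" using k by linarith
  have xa: "x u = a i" if "i \<in> {1..h}" "u \<in> U_cell m i" for i u
    using NSG_neighbour_sum(1)[OF x that] k by (simp add: a_def field_simps)
  have xb: "x u = b i" if "i \<in> {1..h}" "u \<in> V_cell n i" for i u
    using NSG_neighbour_sum(2)[OF x that] k1 by (simp add: b_def nonzero_eq_divide_eq mult.commute)
  have NV: "?NV i = n i * b i" and NU: "?NU i = m i * a i" if "i \<in> {1..h}" for i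
    using xa xb that by (simp_all add: card_cells)
  have ka: "k * a i = (\<Sum>j=1..i. ?NV j)" for i using k by (simp add: a_def)
  have kb: "(k + 1) * b i = (\<Sum>j=1..h. ?NV j) + (\<Sum>j=i..h. ?NU j)" for i
    using k1 by (simp add: b_def)
  show thesis
  proof (rule that[of a b])
    show "k * a 1 = n 1 * b 1" using NV[of 1] h by (simp add: ka)
    show "k * a (Suc i) = k * a i + n (Suc i) * b (Suc i)" if "1 \<le> i" "i < h" for i
      using NV[of "Suc i"] that by (simp add: ka)
    show "(k + 1) * b i = (k + 1) * b (Suc i) + m i * a i" if "1 \<le> i" "i < h" for i
      using NU[of i] that by (simp only: kb sum.atLeast_Suc_atMost[of i h]) simp
    \<comment> \<open>The total over all \<open>V\<close> cells is \<open>k * a h\<close>, and only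
      the last \<open>U\<close> cell remains in the other sum.\<close>
    show "(k + 1) * b h = (k + m h) * a h"
      using NU[of h] h by (simp only: kb ka[symmetric]) (simp add: algebra_simps)
  qed (use xa xb in auto)
qed

lemma NSG_eigenfunction_vanishes:
  fixes x :: "nsg_vertex \<Rightarrow> real"
  assumes x: "eigenfunction (with_proj (NSG h m n)) k x" and h: "h \<ge> 1"
    and n1: "n 1 > 0" and k: "k \<noteq> 0" "k \<noteq> -1"
    and v: "v \<in> U_cell m 1 \<union> V_cell n 1 \<union> U_cell m h \<or> v \<in> V_cell n h \<and> k \<noteq> - real (m h)"
    and xv: "x v = 0" and u: "u \<in> nsg_verts h m n"
  shows "x u = 0"
proof (rule NSG_cell_equations[OF x h k])
  fix a b :: "nat \<Rightarrow> real"
  assume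
    xa: "\<And>i u. i \<in> {1..h} \<Longrightarrow> u \<in> U_cell m i \<Longrightarrow> x u = a i" and
    xb: "\<And>i u. i \<in> {1..h} \<Longrightarrow> u \<in> V_cell n i \<Longrightarrow> x u = b i" and
    first: "k * a 1 = n 1 * b 1" and
    a: "\<And>i. 1 \<le> i \<Longrightarrow> i < h \<Longrightarrow> k * a (Suc i) = k * a i + n (Suc i) * b (Suc i)" and
    b: "\<And>i. 1 \<le> i \<Longrightarrow> i < h \<Longrightarrow> (k + 1) * b i = (k + 1) * b (Suc i) + m i * a i" and
    last: "(k + 1) * b h = (k + m h) * a h"
  have k1: "k + 1 \<noteq> 0" using k by linarith
  \<comment> \<open>At either end the boundary equation passes the zero to the partner cell. Passing
    from \<open>b h\<close> to \<open>a h\<close> divides by \<open>k + m h\<close>, hence the extra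
    condition on \<open>v\<close>.\<close>
  have *: "a 1 = 0 \<and> b 1 = 0 \<or> a h = 0 \<and> b h = 0"
    using v xv xa[of 1 v] xb[of 1 v] xa[of h v] xb[of h v] h first last k k1 n1 by auto
  have "a i = 0 \<and> b i = 0" if "i \<in> {1..h}" for i
    using *
  proof
    assume start: "a 1 = 0 \<and> b 1 = 0"
    have "1 \<le> i" "i \<le> h" using that by auto
    then show ?thesis
    proof (induction i rule: dec_induct)
      case base
      then show ?case using start by simp
    next
      case (step j)
      \<comment> \<open>Going forwards, \<open>b\<close> must come first, because the equation for
        \<open>a (Suc j)\<close> involves \<open>b (Suc j)\<close>. Going backwards,
        \<open>a j\<close> comes first.\<close>
      then have "b (Suc j) = 0" using b[of j] k1 by auto
      then show ?case using step a[of j] k by auto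
    qed
  next
    assume start: "a h = 0 \<and> b h = 0"
    have "i \<le> h" "1 \<le> i" using that by auto
    then show ?thesis
    proof (induction i rule: inc_induct)
      case base
      then show ?case using start by simp
    next
      case (step j)
      then have "a j = 0" using a[of j] k by auto
      then show ?case using step b[of j] k1 by auto
    qed
  qed
  then show "x u = 0"
    using u xa xb by (auto simp: nsg_verts_def)
qed

theorem theorem2p3:
  fixes h :: nat and m n :: "nat \<Rightarrow> nat" and \<theta> :: real
  assumes "h \<ge> 1"
    and "\<And>i. i \<in> {1..h} \<Longrightarrow> m i > 0"
    and "\<And>i. i \<in> {1..h} \<Longrightarrow> n i > 0"
    and "graph_eigenvalue (NSG h m n) \<theta>"
    and "\<theta> \<noteq> 0" and "\<theta> \<noteq> -1"
    and "\<theta> \<noteq> largest_eigenvalue (NSG h m n)"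
  shows "(\<forall>v \<in> U_cell m 1 \<union> V_cell n 1. downer_vertex (NSG h m n) \<theta> v) \<and>
         (\<forall>v \<in> U_cell m h. downer_vertex (NSG h m n) \<theta> v) \<and>
         (\<not> (\<theta> = - real (m h) \<and> m h \<ge> 2) \<longrightarrow>
            (\<forall>v \<in> V_cell n h. downer_vertex (NSG h m n) \<theta> v))"
proof -
  have downer: "downer_vertex (NSG h m n) \<theta> v"
    if v: "v \<in> U_cell m 1 \<union> V_cell n 1 \<union> U_cell m h \<or> v \<in> V_cell n h \<and> \<theta> \<noteq> - real (m h)" for v
  proof (rule downer_vertexI)
    show "v \<in> verts (NSG h m n)"
      using v assms(1) by (auto simp: pverts_NSG nsg_verts_def)
    show "y u = 0" if "eigenfunction (NSG h m n) \<theta> y" "y v = 0" "u \<in> verts (NSG h m n)" for y u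
      using NSG_eigenfunction_vanishes[OF that(1) assms(1) _ assms(5,6) v that(2)] that(3)
        assms(1,3) by (simp add: pverts_NSG)
  qed (use assms(4) in \<open>auto simp: pverts_NSG parcs_NSG finite_nsg_verts intro: nsg_adj_sym\<close>)
  \<comment> \<open>If \<open>m h = 1\<close>, then \<open>\<theta> = - m h\<close> would be the
    excluded value -1, so the exception only concerns \<open>m h \<ge> 2\<close>.\<close>
  have "\<theta> \<noteq> - real (m h)" if "\<not> (\<theta> = - real (m h) \<and> m h \<ge> 2)"
  proof
    assume "\<theta> = - real (m h)"
    moreover from this have "m h = 1" using that assms(1) assms(2)[of h] by auto
    ultimately show False using assms(6) by simp
  qed
  with downer show ?thesis by auto
qed

end
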